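(* Let $G$ be a compact group whose FC-centre $F$ is open in $G$, and let $\alpha:G\times G\to G$, $\alpha(x,y)=[x,y]=xyx^{-1}y^{-1}$, be the commutator map. Then for every $g\in F$, $$\mu(\alpha^{-1}(g))=\mu\big(\{(x,y)\in F^2:[x,y]=g\}\big).$$
   Context: The FC-centre of a group $G$ is $F=FC(G)=\{g\in G:\text{the conjugacy class of } g \text{ in } G \text{ is finite}\}$, a normal subgroup of $G$. Here $\mu$, applied to subsets of $G\times G$ (on both sides of the equality), denotes the normalised Haar measure on $G\times G$, i.e. the product of the normalised Haar measure of $G$ with itself. *)

theory Defs
  imports "HOL-Analysis.Analysis" "HOL-Algebra.Coset"
begin

(* Compact groups are Hausdorff by convention. *)
locale compact_group = group G for G :: "('a, 'b) monoid_scheme" (structure) +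
  fixes T :: "'a topology"
  assumes topspace_eq: "topspace T = carrier G"
    and continuous_mult: "continuous_map (prod_topology T T) T (\<lambda>(x, y). x \<otimes> y)"
    and continuous_inv: "continuous_map T T (\<lambda>x. inv x)"
    and Hausdorff: "Hausdorff_space T"
    and compact: "compact_space T"

(* Borel probability measures that are left-invariant and inner regular with respect to
   compact sets. For a compact group there is exactly one such measure. *)
definition normalised_haar_measure ::
    "('a, 'b) monoid_scheme \<Rightarrow> 'a topology \<Rightarrow> 'a measure \<Rightarrow> bool" where
  "normalised_haar_measure G T M \<longleftrightarrow>
     space M = topspace T \<and>
     sets M = sigma_sets (topspace T) {U. openin T U} \<and>
     emeasure M (space M) = 1 \<and>
     (\<forall>a\<in>carrier G. \<forall>A\<in>sets M. emeasure M (a <#\<^bsub>G\<^esub> A) = emeasure M A) \<and>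
     (\<forall>A\<in>sets M. emeasure M A = (SUP K\<in>{K. compactin T K \<and> K \<subseteq> A}. emeasure M K))"

definition FC_centre :: "('a, 'b) monoid_scheme \<Rightarrow> 'a set" where
  "FC_centre G =
     {g \<in> carrier G. finite {x \<otimes>\<^bsub>G\<^esub> g \<otimes>\<^bsub>G\<^esub> inv\<^bsub>G\<^esub> x | x. x \<in> carrier G}}"

definition commutator_map :: "('a, 'b) monoid_scheme \<Rightarrow> 'a \<times> 'a \<Rightarrow> 'a" where
  "commutator_map G = (\<lambda>(x, y). x \<otimes>\<^bsub>G\<^esub> y \<otimes>\<^bsub>G\<^esub> inv\<^bsub>G\<^esub> x \<otimes>\<^bsub>G\<^esub> inv\<^bsub>G\<^esub> y)"

(* The measure on the product of a compact group with itself is taken to be the normalised Haar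
   measure of the group below. It extends the product of the Haar measures of the factors. The
   product measure on the product sigma-algebra would not do in general: without second
   countability, fibres of the commutator map are closed but need not be measurable there. *)
lemma compact_group_DirProd:
  fixes G (structure)
  assumes "compact_group G T"
  shows "compact_group (G \<times>\<times> G) (prod_topology T T)"
proof -
  interpret compact_group G T by fact
  interpret P: group "G \<times>\<times> G" by (intro DirProd_group group_axioms)
  let ?P = "prod_topology T T"
  note f = continuous_map_fst and s = continuous_map_snd
  have m: "continuous_map (prod_topology ?P ?P) T (\<lambda>z. h (fst z) \<otimes> h (snd z))"
    if h: "continuous_map ?P T h" for h
  proof -
    have "continuous_map (prod_topology ?P ?P) ?P (\<lambda>z. (h (fst z), h (snd z)))"
      using continuous_map_compose[OF f h] continuous_map_compose[OF s h]
      by (intro continuous_map_pairedI) (simp_all add: o_def)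
    from continuous_map_compose[OF this continuous_mult] show ?thesis
      by (simp add: o_def)
  qed
  have i: "continuous_map ?P T (\<lambda>z. inv (h z))" if h: "continuous_map ?P T h" for h
    using continuous_map_compose[OF h continuous_inv] by (simp add: o_def)
  show ?thesis
  proof
    show "topspace ?P = carrier (G \<times>\<times> G)"
      by (simp add: topspace_eq)
    show "continuous_map (prod_topology ?P ?P) ?P (\<lambda>(x, y). x \<otimes>\<^bsub>G \<times>\<times> G\<^esub> y)"
      using continuous_map_pairedI[OF m[OF f] m[OF s]]
      by (simp add: mult_DirProd' case_prod_unfold)
    show "continuous_map ?P ?P (\<lambda>x. inv\<^bsub>G \<times>\<times> G\<^esub> x)"
      by (rule continuous_map_eq[OF continuous_map_pairedI[OF i[OF f] i[OF s]]])
        (auto simp: topspace_eq inv_DirProd[OF group_axioms group_axioms])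
  qed (use Hausdorff compact in \<open>auto simp: Hausdorff_space_prod_topology compact_space_prod_topology\<close>)
qed

end

theory Submission
  imports Defs
begin

text \<open>
  If \<open>y\<close> has infinitely many conjugates, then the solutions \<open>x\<close> of \<open>[x, y] = g\<close>, that is of
  \<open>x y x\<inverse> = g y\<close>, form a left coset of the centraliser of \<open>y\<close> or the empty set. The centraliser
  has infinite index, so infinitely many left translates of the solution set are pairwise disjoint.
  By Fubini's theorem the solutions \<open>(x, y)\<close> with \<open>y \<notin> F\<close> then form a null set. The same
  holds for the solutions with \<open>x \<notin> F\<close>, where \<open>[x, y] = g\<close> is rewritten as \<open>y x y\<inverse> = g\<inverse> x\<close>.
  What remains of the fibre of \<open>g\<close> is its part in \<open>F \<times> F\<close>. That \<open>F\<close> is open makes both of the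
  removed parts closed, hence measurable.

  Only the Haar measure of \<open>G \<times> G\<close> is at hand, not a disintegration of it, so Fubini's theorem is
  replaced by a compactness argument (lemma \<open>closed_null_by_disjoint_fibre_translates\<close>). For
  a closed set \<open>A\<close>, disjointness of finitely many translates over one point \<open>y\<close> of the base
  persists over a neighbourhood of \<open>y\<close>. Over a saturated measurable set on which \<open>n\<close> translates
  of \<open>A\<close> are disjoint, \<open>A\<close> occupies at most the proportion \<open>1/n\<close>. Finitely many such sets
  cover \<open>A\<close>, and cutting them into disjoint saturated pieces bounds the measure of \<open>A\<close> by \<open>1/n\<close>.
\<close>

section \<open>Null sets with disjoint fibre translates\<close>

lemma
  assumes "normalised_haar_measure G T \<mu>"
  shows finite_measure_haar: "finite_measure \<mu>"
    and openin_sets_haar: "openin T U \<Longrightarrow> U \<in> sets \<mu>"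
    and closedin_sets_haar: "closedin T A \<Longrightarrow> A \<in> sets \<mu>"
proof -
  have one: "emeasure \<mu> (space \<mu>) = 1"
    and sets: "sets \<mu> = sigma_sets (topspace T) {U. openin T U}"
    using assms unfolding normalised_haar_measure_def by metis+
  show "finite_measure \<mu>"
    by (rule finite_measureI) (simp add: one)
  show "U \<in> sets \<mu>" if "openin T U" for U
    unfolding sets using that by (intro sigma_sets.Basic) simp
  show "A \<in> sets \<mu>" if "closedin T A"
  proof -
    have "topspace T - (topspace T - A) \<in> sigma_sets (topspace T) {U. openin T U}"
      using that by (intro sigma_sets.Compl sigma_sets.Basic) (simp add: closedin_def)
    then show ?thesis
      unfolding sets using closedin_subset[OF that] by (simp add: double_diff)
  qed
qed

context compact_group
begin

lemma closedin_l_coset: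
  assumes "s \<in> carrier G" "closedin T A"
  shows "closedin T (s <# A)"
proof -
  have "continuous_map T (prod_topology T T) (\<lambda>x. (s, x))"
    using assms(1) by (intro continuous_map_pairedI) (auto simp: topspace_eq)
  from continuous_map_compose[OF this continuous_mult]
  have "continuous_map T T (\<lambda>x. s \<otimes> x)" by (simp add: o_def)
  moreover have "compactin T A"
    using assms(2) compact by (rule closedin_compact_space[rotated])
  ultimately have "compactin T ((\<lambda>x. s \<otimes> x) ` A)"
    by (rule image_compactin[rotated])
  moreover have "(\<lambda>x. s \<otimes> x) ` A = s <# A"
    by (auto simp: l_coset_def)
  ultimately show ?thesis
    using compactin_imp_closedin[OF Hausdorff] by simp
qed

lemma l_coset_Int_saturated:
  assumes "s \<in> carrier G" "A \<subseteq> carrier G"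
    and "\<And>w. w \<in> carrier G \<Longrightarrow> s \<otimes> w \<in> W \<longleftrightarrow> w \<in> W"
  shows "s <# (A \<inter> W) = (s <# A) \<inter> W"
  using assms by (auto simp: l_coset_def)

text \<open>
  The translates of \<open>A \<inter> W\<close> all have the same measure, and the saturated set \<open>W\<close> has room for
  \<open>card N\<close> disjoint copies.
\<close>

lemma measure_Int_saturated_le:
  assumes \<mu>: "normalised_haar_measure G T \<mu>"
    and A: "closedin T A"
    and N: "finite N" "N \<subseteq> carrier G"
    and W: "W \<in> sets \<mu>"
    and sat: "\<And>s w. s \<in> N \<Longrightarrow> w \<in> carrier G \<Longrightarrow> s \<otimes> w \<in> W \<longleftrightarrow> w \<in> W"
    and disj: "\<And>s t. s \<in> N \<Longrightarrow> t \<in> N \<Longrightarrow> s \<noteq> t \<Longrightarrow> (s <# A) \<inter> (t <# A) \<inter> W = {}"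
  shows "real (card N) * measure \<mu> (A \<inter> W) \<le> measure \<mu> W"
proof -
  interpret finite_measure \<mu>
    using \<mu> by (rule finite_measure_haar)
  note closed_sets = closedin_sets_haar[OF \<mu>]
  have sub: "A \<subseteq> carrier G"
    using closedin_subset[OF A] by (simp add: topspace_eq)
  have eq: "s <# (A \<inter> W) = (s <# A) \<inter> W" if "s \<in> N" for s
    using that N sat sub by (intro l_coset_Int_saturated) auto
  have meas: "s <# (A \<inter> W) \<in> sets \<mu>" if "s \<in> N" for s
    unfolding eq[OF that] using that N W by (intro sets.Int[OF closed_sets] closedin_l_coset A) auto
  have "measure \<mu> (s <# (A \<inter> W)) = measure \<mu> (A \<inter> W)" if "s \<in> N" for s
  proof -
    have "A \<inter> W \<in> sets \<mu>" using W closed_sets[OF A] by blast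
    then show ?thesis using \<mu> that N by (auto simp: normalised_haar_measure_def measure_def)
  qed
  then have "real (card N) * measure \<mu> (A \<inter> W) = (\<Sum>s\<in>N. measure \<mu> (s <# (A \<inter> W)))"
    by simp
  also have "\<dots> = measure \<mu> (\<Union>s\<in>N. s <# (A \<inter> W))"
  proof (rule finite_measure_finite_Union[symmetric])
    show "disjoint_family_on (\<lambda>s. s <# (A \<inter> W)) N"
      using disj by (auto simp: disjoint_family_on_def eq)
  qed (use N meas in auto)
  also have "\<dots> \<le> measure \<mu> W"
    using W eq by (intro finite_measure_mono) auto
  finally show ?thesis .
qed

text \<open>
  Here \<open>q\<close> projects onto the base, \<open>S\<close> translates along its fibres, and the last hypothesis says
  that each nonempty fibre of \<open>A\<close> has infinitely many pairwise disjoint translates. Sets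
  saturated under \<open>S\<close> replace preimages under \<open>q\<close>, since they are stable under the Boolean
  operations needed for cutting a finite cover into disjoint pieces.
\<close>

lemma closed_null_by_disjoint_fibre_translates:
  assumes \<mu>: "normalised_haar_measure G T \<mu>"
    and A: "closedin T A"
    and q: "continuous_map T Y q" and Y: "Hausdorff_space Y"
    and S: "S \<subseteq> carrier G"
    and qS: "\<And>s h. s \<in> S \<Longrightarrow> h \<in> carrier G \<Longrightarrow> q (s \<otimes> h) = q h"
    and fibre: "\<And>y. y \<in> q ` A \<Longrightarrow> \<exists>N\<subseteq>S. infinite N \<and>
      (\<forall>s\<in>N. \<forall>t\<in>N. s \<noteq> t \<longrightarrow>
        (\<forall>u\<in>A. \<forall>v\<in>A. q u = y \<longrightarrow> q v = y \<longrightarrow> s \<otimes> u \<noteq> t \<otimes> v))"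
  shows "A \<in> null_sets \<mu>"
proof -
  interpret finite_measure \<mu>
    using \<mu> by (rule finite_measure_haar)
  note open_sets = openin_sets_haar[OF \<mu>]
  have A_sets: "A \<in> sets \<mu>" using \<mu> A by (rule closedin_sets_haar)
  have sub: "A \<subseteq> carrier G"
    using closedin_subset[OF A] by (simp add: topspace_eq)
  define saturated where
    "saturated W \<longleftrightarrow> (\<forall>s\<in>S. \<forall>w\<in>carrier G. s \<otimes> w \<in> W \<longleftrightarrow> w \<in> W)" for W
  define spread where
    "spread n W \<longleftrightarrow> (\<exists>N\<subseteq>S. finite N \<and> card N = n \<and>
      (\<forall>s\<in>N. \<forall>t\<in>N. s \<noteq> t \<longrightarrow> (s <# A) \<inter> (t <# A) \<inter> W = {}))" for n W
  have bound: "real n * measure \<mu> (A \<inter> W) \<le> measure \<mu> W"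
    if W: "W \<in> sets \<mu>" "saturated W" and spread: "spread n W" for n W
  proof -
    obtain N where "N \<subseteq> S" "finite N" "card N = n"
      "\<And>s t. s \<in> N \<Longrightarrow> t \<in> N \<Longrightarrow> s \<noteq> t \<Longrightarrow> (s <# A) \<inter> (t <# A) \<inter> W = {}"
      using spread unfolding spread_def by metis
    then show ?thesis
      using measure_Int_saturated_le[OF \<mu> A, of N W] W S
      by (auto simp: saturated_def subset_iff)
  qed
  \<comment> \<open>The images under \<open>q\<close> of the intersections of translates are compact, hence closed, and miss
    \<open>q p\<close>. The complement of their union is the neighbourhood over which the translates stay
    disjoint.\<close>
  have local: "\<exists>U. openin T U \<and> p \<in> U \<and> saturated U \<and> spread n U" if p: "p \<in> A" for n p
  proof -
    obtain N' where N': "N' \<subseteq> S" "infinite N'" and dis: "\<forall>s\<in>N'. \<forall>t\<in>N'. s \<noteq> t \<longrightarrow>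
        (\<forall>u\<in>A. \<forall>v\<in>A. q u = q p \<longrightarrow> q v = q p \<longrightarrow> s \<otimes> u \<noteq> t \<otimes> v)"
      using fibre[of "q p"] p by blast
    obtain N where N: "N \<subseteq> N'" "finite N" "card N = n"
      using infinite_arbitrarily_large[OF N'(2)] by metis
    define D where "D = {z \<in> N \<times> N. fst z \<noteq> snd z}"
    define C where "C = (\<Union>(s, t)\<in>D. q ` ((s <# A) \<inter> (t <# A)))"
    define U where "U = {x \<in> topspace T. q x \<in> topspace Y - C}"
    have "closedin Y C"
      unfolding C_def
    proof (rule closedin_Union)
      show "finite ((\<lambda>(s, t). q ` ((s <# A) \<inter> (t <# A))) ` D)"
        using N by (simp add: D_def)
    next
      fix K assume "K \<in> (\<lambda>(s, t). q ` ((s <# A) \<inter> (t <# A))) ` D"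
      then obtain s t where K: "K = q ` ((s <# A) \<inter> (t <# A))" and "s \<in> N" "t \<in> N"
        by (auto simp: D_def)
      then have "closedin T ((s <# A) \<inter> (t <# A))"
        using N N' S A by (intro closedin_Int closedin_l_coset) auto
      then show "closedin Y K"
        unfolding K using compact
        by (intro compactin_imp_closedin[OF Y] image_compactin[OF _ q])
          (rule closedin_compact_space)
    qed
    then have "openin Y (topspace Y - C)" by blast
    then have "openin T U"
      unfolding U_def by (rule openin_continuous_map_preimage[OF q])
    moreover have "q p \<notin> C"
    proof
      assume "q p \<in> C"
      then obtain s t u v where st: "s \<in> N" "t \<in> N" "s \<noteq> t" and uv: "u \<in> A" "v \<in> A"
        and e: "s \<otimes> u = t \<otimes> v" "q (s \<otimes> u) = q p"
        by (auto simp: C_def D_def l_coset_def)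
      have "q u = q p" "q v = q p"
        using qS[of s u] qS[of t v] st uv e N(1) N'(1) sub by (simp_all add: subset_iff)
      then show False using dis st uv e N by blast
    qed
    then have "p \<in> U"
      using p sub continuous_map_image_subset_topspace[OF q] by (auto simp: U_def topspace_eq)
    moreover have "saturated U"
      using qS S by (auto simp: saturated_def U_def topspace_eq)
    moreover have "(s <# A) \<inter> (t <# A) \<inter> U = {}" if "s \<in> N" "t \<in> N" "s \<noteq> t" for s t
      using that by (auto simp: U_def C_def D_def)
    then have "spread n U"
      unfolding spread_def using N N' by (intro exI[of _ N]) auto
    ultimately show ?thesis by blast
  qed
  have le: "real n * measure \<mu> A \<le> measure \<mu> (space \<mu>)" for n
  proof -
    define \<U> where "\<U> = {U. openin T U \<and> saturated U \<and> spread n U}"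
    have "compactin T A"
      using A compact by (rule closedin_compact_space[rotated])
    moreover have "A \<subseteq> \<Union>\<U>" using local[of _ n] by (auto simp: \<U>_def)
    ultimately obtain \<F> where \<F>: "finite \<F>" "\<F> \<subseteq> \<U>" "A \<subseteq> \<Union>\<F>"
      unfolding compactin_def by (metis (no_types, lifting) \<U>_def mem_Collect_eq)
    have "real n * measure \<mu> (A \<inter> \<Union>\<F>) \<le> measure \<mu> (\<Union>\<F>)"
      using \<F>(1,2)
    proof (induction \<F> rule: finite_induct)
      case empty
      then show ?case by simp
    next
      case (insert U \<C>)
      let ?W = "U - \<Union>\<C>"
      have U: "U \<in> sets \<mu>" "saturated U" "spread n U"
        and \<C>: "\<Union>\<C> \<in> sets \<mu>" "saturated (\<Union>\<C>)"
        using insert.prems insert.hyps(1) open_sets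
        by (auto simp: \<U>_def saturated_def subset_iff intro!: sets.finite_Union)
      have "real n * measure \<mu> (A \<inter> ?W) \<le> measure \<mu> ?W"
      proof (rule bound)
        show "spread n ?W" using U(3) unfolding spread_def by blast
      qed (use U \<C> in \<open>auto simp: saturated_def\<close>)
      moreover have "real n * measure \<mu> (A \<inter> \<Union>\<C>) \<le> measure \<mu> (\<Union>\<C>)"
        using insert by blast
      moreover have "measure \<mu> (\<Union>(insert U \<C>)) = measure \<mu> ?W + measure \<mu> (\<Union>\<C>)"
        using U \<C> by (subst finite_measure_Union[symmetric]) (auto intro!: arg_cong[of _ _ "measure \<mu>"])
      moreover have "measure \<mu> (A \<inter> \<Union>(insert U \<C>)) =
          measure \<mu> (A \<inter> ?W) + measure \<mu> (A \<inter> \<Union>\<C>)"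
        using U \<C> A_sets
        by (subst finite_measure_Union[symmetric]) (auto intro!: arg_cong[of _ _ "measure \<mu>"])
      ultimately show ?case by (simp add: distrib_left)
    qed
    moreover have "A \<inter> \<Union>\<F> = A" using \<F> by blast
    ultimately show ?thesis
      using bounded_measure[of "\<Union>\<F>"] by simp
  qed
  have "measure \<mu> A = 0"
  proof (rule ccontr)
    assume "measure \<mu> A \<noteq> 0"
    then have "0 < measure \<mu> A" by (simp add: zero_less_measure_iff)
    from reals_Archimedean3[OF this]
    obtain n where "measure \<mu> (space \<mu>) < real n * measure \<mu> A" by blast
    with le[of n] show False by simp
  qed
  then show ?thesis
    using A_sets by (auto simp: emeasure_eq_measure)
qed

section \<open>Conjugators and fibres of the commutator map\<close>

text \<open>
  The elements conjugating \<open>y\<close> to \<open>k\<close> form a left coset of the centraliser of \<open>y\<close>. Its translate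
  by \<open>a\<close> conjugates \<open>y\<close> to \<open>a k a\<inverse>\<close>, so translates by elements giving different conjugates
  of \<open>k\<close> are disjoint.
\<close>

lemma infinite_disjoint_conjugator_translates:
  assumes y: "y \<in> carrier G" "y \<notin> FC_centre G"
    and x: "x \<in> carrier G"
  defines "k \<equiv> x \<otimes> y \<otimes> inv x"
  shows "\<exists>N\<subseteq>carrier G. infinite N \<and> (\<forall>a\<in>N. \<forall>b\<in>N. a \<noteq> b \<longrightarrow>
    (\<forall>u\<in>carrier G. \<forall>v\<in>carrier G. u \<otimes> y \<otimes> inv u = k \<longrightarrow> v \<otimes> y \<otimes> inv v = k \<longrightarrow>
      a \<otimes> u \<noteq> b \<otimes> v))"
proof -
  let ?c = "\<lambda>a. a \<otimes> k \<otimes> inv a"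
  have conj: "a \<otimes> u \<otimes> y \<otimes> inv (a \<otimes> u) = ?c a"
    if "a \<in> carrier G" "u \<in> carrier G" "u \<otimes> y \<otimes> inv u = k" for a u
    using that y by (auto simp: inv_mult_group m_assoc)
  \<comment> \<open>As \<open>k\<close> is a conjugate of \<open>y\<close>, the two have the same, infinitely many, conjugates.\<close>
  have "{a \<otimes> y \<otimes> inv a | a. a \<in> carrier G} \<subseteq> ?c ` carrier G"
  proof clarify
    fix a assume a: "a \<in> carrier G"
    have "a \<otimes> inv x \<otimes> x \<otimes> y \<otimes> inv (a \<otimes> inv x \<otimes> x) = ?c (a \<otimes> inv x)"
      using a x by (intro conj) (auto simp: k_def)
    moreover have "a \<otimes> inv x \<otimes> x = a"
      using a x by (simp add: m_assoc)
    ultimately show "a \<otimes> y \<otimes> inv a \<in> ?c ` carrier G"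
      using a x by (intro image_eqI[of _ _ "a \<otimes> inv x"]) auto
  qed
  moreover have "infinite {a \<otimes> y \<otimes> inv a | a. a \<in> carrier G}"
    using y by (simp add: FC_centre_def)
  ultimately have inf: "infinite (?c ` carrier G)"
    using finite_subset by blast
  obtain N where N: "N \<subseteq> carrier G" "inj_on ?c N" "?c ` carrier G = ?c ` N"
    using subset_image_inj[of "?c ` carrier G" ?c "carrier G"] by auto
  have "infinite N"
    using inf N(3) by auto
  moreover have "a \<otimes> u \<noteq> b \<otimes> v"
    if "a \<in> N" "b \<in> N" "a \<noteq> b" "u \<in> carrier G" "v \<in> carrier G"
      "u \<otimes> y \<otimes> inv u = k" "v \<otimes> y \<otimes> inv v = k" for a b u v
    using conj[of a u] conj[of b v] that N inj_onD[OF N(2), of a b] by (metis subsetD)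
  ultimately show ?thesis using N(1) by blast
qed

lemma continuous_map_mult:
  assumes "continuous_map X T f" "continuous_map X T h"
  shows "continuous_map X T (\<lambda>z. f z \<otimes> h z)"
  using continuous_map_compose[OF continuous_map_pairedI[OF assms] continuous_mult]
  by (simp add: o_def)

lemma continuous_commutator_map: "continuous_map (prod_topology T T) T (commutator_map G)"
proof -
  note inv = continuous_map_compose[OF _ continuous_inv, unfolded o_def]
  show ?thesis
    unfolding commutator_map_def case_prod_unfold
    by (intro continuous_map_mult inv continuous_map_fst continuous_map_snd)
qed

lemma closedin_commutator_fibre:
  assumes "g \<in> carrier G"
  shows "closedin (prod_topology T T) {p \<in> carrier (G \<times>\<times> G). commutator_map G p = g}"
proof -
  have "closedin T {g}"
    using assms Hausdorff by (simp add: closedin_Hausdorff_singleton topspace_eq)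
  from closedin_continuous_map_preimage[OF continuous_commutator_map this]
  show ?thesis by (simp add: topspace_eq)
qed

lemma commutator_eq_iff_conj:
  assumes "x \<in> carrier G" "y \<in> carrier G" "g \<in> carrier G"
  shows "commutator_map G (x, y) = g \<longleftrightarrow> x \<otimes> y \<otimes> inv x = g \<otimes> y"
    and "commutator_map G (x, y) = g \<longleftrightarrow> y \<otimes> x \<otimes> inv y = inv g \<otimes> x"
proof -
  show first: "commutator_map G (x, y) = g \<longleftrightarrow> x \<otimes> y \<otimes> inv x = g \<otimes> y"
    using assms inv_solve_right'[of g "x \<otimes> y \<otimes> inv x" y] by (auto simp: commutator_map_def)
  have "x \<otimes> y \<otimes> inv x = g \<otimes> y \<longleftrightarrow> x \<otimes> y = g \<otimes> y \<otimes> x"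
    using assms inv_solve_right'[of "g \<otimes> y" "x \<otimes> y" x] by auto
  also have "\<dots> \<longleftrightarrow> inv g \<otimes> x \<otimes> y = y \<otimes> x"
    using assms inv_solve_left'[of "y \<otimes> x" g "x \<otimes> y"] by (auto simp: m_assoc)
  also have "\<dots> \<longleftrightarrow> y \<otimes> x \<otimes> inv y = inv g \<otimes> x"
    using assms inv_solve_right'[of "inv g \<otimes> x" "y \<otimes> x" y] by auto
  finally show "commutator_map G (x, y) = g \<longleftrightarrow> y \<otimes> x \<otimes> inv y = inv g \<otimes> x"
    using first by simp
qed

text \<open>
  Solutions with second entry outside \<open>F\<close> are translated in the first entry, where their fibre is
  a set of conjugators of the second entry; for the other case the entries change roles.
\<close>

lemma commutator_fibre_outside_FC_centre_null:
  assumes op: "openin T (FC_centre G)"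
    and \<mu>: "normalised_haar_measure (G \<times>\<times> G) (prod_topology T T) \<mu>"
    and g: "g \<in> carrier G"
  shows "{p \<in> carrier (G \<times>\<times> G). commutator_map G p = g \<and> snd p \<notin> FC_centre G} \<in> null_sets \<mu>"
      (is "?A \<in> _")
    and "{p \<in> carrier (G \<times>\<times> G). commutator_map G p = g \<and> fst p \<notin> FC_centre G} \<in> null_sets \<mu>"
      (is "?B \<in> _")
proof -
  interpret P: compact_group "G \<times>\<times> G" "prod_topology T T"
    by (rule compact_group_DirProd) (rule compact_group_axioms)
  have closed: "closedin (prod_topology T T)
      {p \<in> carrier (G \<times>\<times> G). commutator_map G p = g \<and> q p \<notin> FC_centre G}"
    if q: "continuous_map (prod_topology T T) T q" for q
  proof -
    have "closedin T (topspace T - FC_centre G)" using op by blast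
    from closedin_Int[OF closedin_commutator_fibre[OF g] closedin_continuous_map_preimage[OF q this]]
    show ?thesis
      using continuous_map_image_subset_topspace[OF q]
      by (elim back_subst[of "closedin _"]) (auto simp: topspace_eq)
  qed
  show "?A \<in> null_sets \<mu>"
  proof (rule P.closed_null_by_disjoint_fibre_translates[OF \<mu> closed[OF continuous_map_snd]
      continuous_map_snd Hausdorff, of "(\<lambda>a. (a, \<one>)) ` carrier G"])
    fix y assume "y \<in> snd ` ?A"
    then obtain x where x: "x \<in> carrier G" and y: "y \<in> carrier G" "y \<notin> FC_centre G"
      and "commutator_map G (x, y) = g"
      by auto
    then have k: "x \<otimes> y \<otimes> inv x = g \<otimes> y"
      using g by (simp add: commutator_eq_iff_conj(1))
    obtain N where N: "N \<subseteq> carrier G" "infinite N" "\<forall>a\<in>N. \<forall>b\<in>N. a \<noteq> b \<longrightarrow>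
        (\<forall>u\<in>carrier G. \<forall>v\<in>carrier G. u \<otimes> y \<otimes> inv u = g \<otimes> y \<longrightarrow> v \<otimes> y \<otimes> inv v = g \<otimes> y \<longrightarrow>
          a \<otimes> u \<noteq> b \<otimes> v)"
      using infinite_disjoint_conjugator_translates[OF y x] unfolding k by blast
    have sol: "fst u \<in> carrier G \<and> fst u \<otimes> y \<otimes> inv fst u = g \<otimes> y"
      if "u \<in> ?A" "snd u = y" for u
      using that g y commutator_eq_iff_conj(1)[of "fst u" y g] by auto
    have disj: "s \<otimes>\<^bsub>G \<times>\<times> G\<^esub> u \<noteq> t \<otimes>\<^bsub>G \<times>\<times> G\<^esub> v"
      if st: "s \<in> (\<lambda>a. (a, \<one>)) ` N" "t \<in> (\<lambda>a. (a, \<one>)) ` N" "s \<noteq> t"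
        and uv: "u \<in> ?A" "v \<in> ?A" "snd u = y" "snd v = y" for s t u v
    proof -
      obtain a b where ab: "s = (a, \<one>)" "t = (b, \<one>)" "a \<in> N" "b \<in> N" "a \<noteq> b"
        using st by blast
      have "a \<otimes> fst u \<noteq> b \<otimes> fst v"
        using N(3) ab(3-5) sol[OF uv(1,3)] sol[OF uv(2,4)] by blast
      then show ?thesis
        by (simp add: ab(1,2) mult_DirProd' prod_eq_iff)
    qed
    have "infinite ((\<lambda>a. (a, \<one>)) ` N)"
      using N(2) by (simp add: finite_image_iff inj_on_def)
    then show "\<exists>M\<subseteq>(\<lambda>a. (a, \<one>)) ` carrier G. infinite M \<and>
      (\<forall>s\<in>M. \<forall>t\<in>M. s \<noteq> t \<longrightarrow> (\<forall>u\<in>?A. \<forall>v\<in>?A. snd u = y \<longrightarrow> snd v = y \<longrightarrow>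
        s \<otimes>\<^bsub>G \<times>\<times> G\<^esub> u \<noteq> t \<otimes>\<^bsub>G \<times>\<times> G\<^esub> v))"
      by (intro exI[of _ "(\<lambda>a. (a, \<one>)) ` N"] conjI image_mono N(1) ballI impI disj)
  qed auto
  show "?B \<in> null_sets \<mu>"
  proof (rule P.closed_null_by_disjoint_fibre_translates[OF \<mu> closed[OF continuous_map_fst]
      continuous_map_fst Hausdorff, of "(\<lambda>a. (\<one>, a)) ` carrier G"])
    fix x assume "x \<in> fst ` ?B"
    then obtain y where y: "y \<in> carrier G" and x: "x \<in> carrier G" "x \<notin> FC_centre G"
      and "commutator_map G (x, y) = g"
      by auto
    then have k: "y \<otimes> x \<otimes> inv y = inv g \<otimes> x"
      using g by (simp add: commutator_eq_iff_conj(2))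
    obtain N where N: "N \<subseteq> carrier G" "infinite N" "\<forall>a\<in>N. \<forall>b\<in>N. a \<noteq> b \<longrightarrow>
        (\<forall>u\<in>carrier G. \<forall>v\<in>carrier G. u \<otimes> x \<otimes> inv u = inv g \<otimes> x \<longrightarrow>
          v \<otimes> x \<otimes> inv v = inv g \<otimes> x \<longrightarrow> a \<otimes> u \<noteq> b \<otimes> v)"
      using infinite_disjoint_conjugator_translates[OF x y] unfolding k by blast
    have sol: "snd u \<in> carrier G \<and> snd u \<otimes> x \<otimes> inv snd u = inv g \<otimes> x"
      if "u \<in> ?B" "fst u = x" for u
      using that g x commutator_eq_iff_conj(2)[of x "snd u" g] by auto
    have disj: "s \<otimes>\<^bsub>G \<times>\<times> G\<^esub> u \<noteq> t \<otimes>\<^bsub>G \<times>\<times> G\<^esub> v"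
      if st: "s \<in> (\<lambda>a. (\<one>, a)) ` N" "t \<in> (\<lambda>a. (\<one>, a)) ` N" "s \<noteq> t"
        and uv: "u \<in> ?B" "v \<in> ?B" "fst u = x" "fst v = x" for s t u v
    proof -
      obtain a b where ab: "s = (\<one>, a)" "t = (\<one>, b)" "a \<in> N" "b \<in> N" "a \<noteq> b"
        using st by blast
      have "a \<otimes> snd u \<noteq> b \<otimes> snd v"
        using N(3) ab(3-5) sol[OF uv(1,3)] sol[OF uv(2,4)] by blast
      then show ?thesis
        by (simp add: ab(1,2) mult_DirProd' prod_eq_iff)
    qed
    have "infinite ((\<lambda>a. (\<one>, a)) ` N)"
      using N(2) by (simp add: finite_image_iff inj_on_def)
    then show "\<exists>M\<subseteq>(\<lambda>a. (\<one>, a)) ` carrier G. infinite M \<and>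
      (\<forall>s\<in>M. \<forall>t\<in>M. s \<noteq> t \<longrightarrow> (\<forall>u\<in>?B. \<forall>v\<in>?B. fst u = x \<longrightarrow> fst v = x \<longrightarrow>
        s \<otimes>\<^bsub>G \<times>\<times> G\<^esub> u \<noteq> t \<otimes>\<^bsub>G \<times>\<times> G\<^esub> v))"
      by (intro exI[of _ "(\<lambda>a. (\<one>, a)) ` N"] conjI image_mono N(1) ballI impI disj)
  qed auto
qed

end

section \<open>The measure of a commutator fibre\<close>

theorem theorem5p2:
  fixes G :: "('a, 'b) monoid_scheme" (structure)
    and T :: "'a topology" and \<mu> :: "('a \<times> 'a) measure"
  assumes "compact_group G T"
    and "openin T (FC_centre G)"
    and "normalised_haar_measure (G \<times>\<times> G) (prod_topology T T) \<mu>"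
    and "g \<in> FC_centre G"
  shows "measure \<mu> {p \<in> carrier (G \<times>\<times> G). commutator_map G p = g} =
         measure \<mu> {p \<in> FC_centre G \<times> FC_centre G. commutator_map G p = g}"
proof -
  interpret compact_group G T by fact
  let ?L = "{p \<in> carrier (G \<times>\<times> G). commutator_map G p = g}"
  let ?A = "{p \<in> carrier (G \<times>\<times> G). commutator_map G p = g \<and> snd p \<notin> FC_centre G}"
  let ?B = "{p \<in> carrier (G \<times>\<times> G). commutator_map G p = g \<and> fst p \<notin> FC_centre G}"
  have g: "g \<in> carrier G" using assms(4) by (simp add: FC_centre_def)
  have null: "?A \<union> ?B \<in> null_sets \<mu>"
    using commutator_fibre_outside_FC_centre_null[OF assms(2,3) g] by (rule null_sets.Un)
  have "?L \<in> sets \<mu>"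
    using assms(3) closedin_commutator_fibre[OF g] by (rule closedin_sets_haar)
  from measure_Diff_null_set[OF this null]
  have "measure \<mu> ?L = measure \<mu> (?L - (?A \<union> ?B))" by simp
  also have "?L - (?A \<union> ?B) = {p \<in> FC_centre G \<times> FC_centre G. commutator_map G p = g}"
    by (auto simp: FC_centre_def)
  finally show ?thesis .
qed

end
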